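(* Let $\mathcal{D}\subseteq\mathbb{R}^n$ be open, let $x\in\mathcal{D}$, let $v\colon\mathcal{D}\to\mathbb{R}^n$ be continuous, let $h_1,\ldots,h_p\colon\mathcal{D}\to\mathbb{R}$ be continuously differentiable, and define $h(x)\triangleq\min_{i\in\{1,\ldots,p\}}h_i(x)$. Let $\tilde h(x_{\mathbb{D},v})\triangleq\min_{\Re}\big(\tilde h_1(x_{\mathbb{D},v}),\ldots,\tilde h_p(x_{\mathbb{D},v})\big)$ be the dual-algebraic evaluation of $h$ at $x_{\mathbb{D},v}=x+v(x)\epsilon$, let $\mathcal{A}(x)\triangleq\{i\in\{1,\ldots,p\}: h_i(x)=h(x)\}$, and let $i_*(x)\triangleq\min\mathcal{A}(x)$. Then $$\Re\big(\tilde h(x_{\mathbb{D},v})\big)=h(x),$$ and the gradient $\nabla h_{i_*(x)}(x)$ is a generator of the polytope $\mathrm{co}\{\nabla h_i(x): i\in\mathcal{A}(x)\}$ (i.e. it is one of the vectors $\nabla h_i(x)$, $i\in\mathcal{A}(x)$). In particular, $$\nabla h_{i_*(x)}(x)\in\partial h(x),$$ where $\partial h(x)$ is the Clarke generalized gradient of $h$ at $x$. If the active gradients $\{\nabla h_i(x)\}_{i\in\mathcal{A}(x)}$ are affinely independent, then this generator is a vertex (extreme point) of the polytope. Moreover, the map $x\mapsto i_*(x)$ is a deterministic function of the real values $h_1(x),\ldots,h_p(x)$ alone.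
   Context: The dual-number ring is $\mathbb{D}\triangleq\mathbb{R}[\epsilon]/(\epsilon^2)$; each $z\in\mathbb{D}$ is uniquely $z=a+b\epsilon$ with $a,b\in\mathbb{R}$, $\Re(z)\triangleq a$ and $\mathfrak{D}(z)\triangleq b$. For a continuously differentiable $\eta\colon\mathcal{D}\to\mathbb{R}$ the dual extension is $\tilde\eta(x+w\epsilon)\triangleq\eta(x)+\nabla\eta(x)\,w\,\epsilon\in\mathbb{D}$ for $x\in\mathcal{D}$, $w\in\mathbb{R}^n$. The dual lift of $x$ along $v$ is $x_{\mathbb{D},v}\triangleq x+v(x)\epsilon\in\mathbb{D}^n$. The real-part minimum of $z_1,z_2\in\mathbb{D}$ is $\min_{\Re}(z_1,z_2)\triangleq z_1$ if $\Re(z_1)\le\Re(z_2)$, and $z_2$ otherwise. With $p$ arguments it is applied left-to-right as a binary operation: $\min_\Re(z_1,\ldots,z_p)=\min_\Re(\cdots\min_\Re(\min_\Re(z_1,z_2),z_3)\cdots,z_p)$. Gradients are row vectors, identified with elements of $\mathbb{R}^n$; $\mathrm{co}$ denotes closed convex hull. For a locally Lipschitz $h\colon\mathcal{D}\to\mathbb{R}$, with $\Omega_h\subset\mathcal{D}$ the (Lebesgue null) set where $\nabla h$ is undefined, the Clarke generalized gradient is $\partial h(x)\triangleq\mathrm{co}\{w\in\mathbb{R}^n:\text{ there exists a sequence }(x_k)\subset\mathcal{D}\setminus\Omega_h\text{ with }x_k\to x\text{ and }\nabla h(x_k)\to w\}$. *)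

theory Defs
  imports "HOL-Analysis.Analysis" "HOL-Computational_Algebra.Polynomial"
begin

text \<open>\<open>Dual a b\<close> stands for $a + b\epsilon$. The lemmas \<open>dual_of_poly_*\<close> below exhibit this
  ring as the quotient of the real polynomials by the ideal generated by the square of the
  indeterminate.\<close>

datatype dualnum = Dual (dual_re: real) (dual_du: real)

lemma dualnum_eq_iff: "z = w \<longleftrightarrow> dual_re z = dual_re w \<and> dual_du z = dual_du w"
  by (cases z; cases w) simp

instantiation dualnum :: comm_ring_1
begin

definition "0 = Dual 0 0"
definition "1 = Dual 1 0"
definition "z + w = Dual (dual_re z + dual_re w) (dual_du z + dual_du w)"
definition "- z = Dual (- dual_re z) (- dual_du z)"
definition "z - w = Dual (dual_re z - dual_re w) (dual_du z - dual_du w)"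
definition "z * w =
  Dual (dual_re z * dual_re w) (dual_re z * dual_du w + dual_du z * dual_re w)"

instance
  by standard
    (simp_all add: dualnum_eq_iff zero_dualnum_def one_dualnum_def plus_dualnum_def
      uminus_dualnum_def minus_dualnum_def times_dualnum_def algebra_simps)

end

instantiation dualnum :: real_algebra_1
begin

definition "scaleR r z = Dual (r * dual_re z) (r * dual_du z)"

instance
  by standard
    (simp_all add: dualnum_eq_iff scaleR_dualnum_def plus_dualnum_def times_dualnum_def
      algebra_simps)

end

definition dual_eps :: dualnum where
  "dual_eps = Dual 0 1"

lemma dual_eps_square: "dual_eps * dual_eps = 0"
  by (simp add: dual_eps_def times_dualnum_def zero_dualnum_def)

lemma Dual_eq: "Dual a b = of_real a + of_real b * dual_eps"
  by (simp add: of_real_def dual_eps_def scaleR_dualnum_def one_dualnum_def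
      plus_dualnum_def times_dualnum_def)

lemma dual_re_of_real_add [simp]: "dual_re (of_real a + of_real b * dual_eps) = a"
  by (simp flip: Dual_eq)

lemma dual_du_of_real_add [simp]: "dual_du (of_real a + of_real b * dual_eps) = b"
  by (simp flip: Dual_eq)

definition dual_of_poly :: "real poly \<Rightarrow> dualnum" where
  "dual_of_poly q = Dual (coeff q 0) (coeff q 1)"

lemma dual_of_poly_1: "dual_of_poly 1 = 1"
  by (simp add: dual_of_poly_def one_dualnum_def)

lemma dual_of_poly_add: "dual_of_poly (q + r) = dual_of_poly q + dual_of_poly r"
  by (simp add: dual_of_poly_def plus_dualnum_def)

lemma dual_of_poly_mult: "dual_of_poly (q * r) = dual_of_poly q * dual_of_poly r"
  by (simp add: dual_of_poly_def times_dualnum_def coeff_mult)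

lemma dual_of_poly_surj: "surj dual_of_poly"
proof (rule surjI)
  show "dual_of_poly [:dual_re z, dual_du z:] = z" for z
    by (simp add: dual_of_poly_def)
qed

lemma dual_of_poly_eq_0_iff: "dual_of_poly q = 0 \<longleftrightarrow> [:0, 1:] ^ 2 dvd q"
proof -
  have "[:0, 1:] ^ 2 dvd q \<longleftrightarrow> coeff q 0 = 0 \<and> coeff q 1 = 0"
  proof
    assume "[:0, 1:] ^ 2 dvd q"
    then show "coeff q 0 = 0 \<and> coeff q 1 = 0"
      by (auto simp: power2_eq_square elim!: dvdE)
  next
    assume "coeff q 0 = 0 \<and> coeff q 1 = 0"
    moreover obtain a b r where "q = pCons a (pCons b r)"
      by (metis pCons_cases)
    ultimately have "q = [:0, 1:] ^ 2 * r"
      by (simp add: power2_eq_square)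
    then show "[:0, 1:] ^ 2 dvd q"
      by simp
  qed
  then show ?thesis
    by (simp add: dual_of_poly_def zero_dualnum_def)
qed

text \<open>Row vectors are identified with elements of \<open>real^'n\<close>. The value is meaningful
  only at points where \<open>f\<close> is differentiable.\<close>

definition gradient :: "(real^'n \<Rightarrow> real) \<Rightarrow> real^'n \<Rightarrow> real^'n" where
  "gradient f x = (THE g. GDERIV f x :> g)"

lemma gradient_eqI:
  assumes "GDERIV f x :> g"
  shows "gradient f x = g"
  unfolding gradient_def
proof (rule the_equality)
  show "GDERIV f x :> g" by (rule assms)
next
  fix g' assume "GDERIV f x :> g'"
  then have "(\<lambda>w. w \<bullet> g') = (\<lambda>w. w \<bullet> g)"
    using assms unfolding gderiv_def by (rule has_derivative_unique)
  then show "g' = g"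
    by (metis inner_commute vector_eq_ldot)
qed

lemma GDERIV_gradient:
  assumes "f differentiable (at x)"
  shows "GDERIV f x :> gradient f x"
proof -
  obtain f' where f': "(f has_derivative f') (at x)"
    using assms unfolding differentiable_def by blast
  then have lin: "linear f'"
    by (rule has_derivative_linear)
  have "f' = (\<lambda>w. w \<bullet> adjoint f' 1)"
    by (simp add: adjoint_works[OF lin])
  with f' have "GDERIV f x :> adjoint f' 1"
    unfolding gderiv_def by simp
  then show ?thesis
    using gradient_eqI by metis
qed

text \<open>Functions on an open set \<open>D\<close> are represented by total functions, of which only the
  values on \<open>D\<close> are relevant.\<close>

definition continuously_differentiable_on :: "(real^'n) set \<Rightarrow> (real^'n \<Rightarrow> real) \<Rightarrow> bool" where
  "continuously_differentiable_on D f \<longleftrightarrow>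
     (\<forall>x\<in>D. f differentiable (at x)) \<and> continuous_on D (gradient f)"

definition dual_lift :: "(real^'n \<Rightarrow> real^'n) \<Rightarrow> real^'n \<Rightarrow> dualnum^'n" where
  "dual_lift v x = (\<chi> j. of_real (x $ j) + of_real (v x $ j) * dual_eps)"

definition dual_extension :: "(real^'n \<Rightarrow> real) \<Rightarrow> dualnum^'n \<Rightarrow> dualnum" where
  "dual_extension f z =
     (let x = (\<chi> j. dual_re (z $ j)); w = (\<chi> j. dual_du (z $ j))
      in of_real (f x) + of_real (gradient f x \<bullet> w) * dual_eps)"

lemma dual_extension_lift:
  "dual_extension f (dual_lift v x) = of_real (f x) + of_real (gradient f x \<bullet> v x) * dual_eps"
  by (simp add: dual_extension_def dual_lift_def)

definition real_part_min :: "dualnum \<Rightarrow> dualnum \<Rightarrow> dualnum" where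
  "real_part_min z w = (if dual_re z \<le> dual_re w then z else w)"

definition real_part_min_list :: "dualnum list \<Rightarrow> dualnum" where
  "real_part_min_list zs = foldl real_part_min (hd zs) (tl zs)"

text \<open>A family $h_1,\dots,h_p$ is given as \<open>hs :: nat \<Rightarrow> _\<close>, of which only the members with
  index in \<open>{1..p}\<close> are relevant; \<open>p \<ge> 1\<close> is assumed throughout.\<close>

definition min_fun :: "nat \<Rightarrow> (nat \<Rightarrow> real^'n \<Rightarrow> real) \<Rightarrow> real^'n \<Rightarrow> real" where
  "min_fun p hs x = Min ((\<lambda>i. hs i x) ` {1..p})"

definition dual_min_fun :: "nat \<Rightarrow> (nat \<Rightarrow> real^'n \<Rightarrow> real) \<Rightarrow> dualnum^'n \<Rightarrow> dualnum" where
  "dual_min_fun p hs z = real_part_min_list (map (\<lambda>i. dual_extension (hs i) z) [1..<Suc p])"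

definition active_set :: "nat \<Rightarrow> (nat \<Rightarrow> real^'n \<Rightarrow> real) \<Rightarrow> real^'n \<Rightarrow> nat set" where
  "active_set p hs x = {i \<in> {1..p}. hs i x = min_fun p hs x}"

definition min_active :: "nat \<Rightarrow> (nat \<Rightarrow> real^'n \<Rightarrow> real) \<Rightarrow> real^'n \<Rightarrow> nat" where
  "min_active p hs x = Min (active_set p hs x)"

definition closed_convex_hull :: "(real^'n) set \<Rightarrow> (real^'n) set" where
  "closed_convex_hull S = closure (convex hull S)"

text \<open>Intended for \<open>f\<close> locally Lipschitz on the open set \<open>D\<close>, in which case the set of points
  of non-differentiability is Lebesgue null by Rademacher's theorem.\<close>

definition clarke_gradient ::
    "(real^'n) set \<Rightarrow> (real^'n \<Rightarrow> real) \<Rightarrow> real^'n \<Rightarrow> (real^'n) set" where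
  "clarke_gradient D f x = closed_convex_hull
     {w. \<exists>X :: nat \<Rightarrow> real^'n.
           (\<forall>k. X k \<in> D - {y \<in> D. \<not> f differentiable (at y)}) \<and>
           X \<longlonglongrightarrow> x \<and> (\<lambda>k. gradient f (X k)) \<longlonglongrightarrow> w}"

end

theory Submission
  imports Defs
begin

text \<open>The Clarke gradient of a minimum contains the gradient of every active member \<open>f a\<close>, even
  one that is nowhere strictly active near \<open>x\<close>. On the interior of \<open>{f i = h}\<close> the
  gradients of \<open>h\<close> and \<open>f i\<close> agree, and these interiors are dense because finitely
  many closed sets cover \<open>D\<close>; so no appeal to Rademacher's theorem is needed. If a hyperplane with
  normal \<open>d\<close> strictly separated the gradient of \<open>f a\<close> at \<open>x\<close> from the Clarke
  gradient, then on a short segment from \<open>x\<close> in the direction \<open>d\<close> every member whose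
  interior accumulates at \<open>x\<close> would lie strictly above \<open>f a\<close>, although one of them must
  attain the minimum there.\<close>

section \<open>Real part of the dual evaluation, and the selected index\<close>

lemma dual_re_real_part_min: "dual_re (real_part_min z w) = min (dual_re z) (dual_re w)"
  by (simp add: real_part_min_def min_def)

text \<open>Taking real parts turns \<open>real_part_min\<close> into \<open>min\<close>, which is
  associative, so the folding order and the tie-breaking leave no trace. The accumulator stays
  arbitrary for the induction.\<close>

lemma dual_re_foldl_real_part_min:
  "dual_re (foldl real_part_min z zs) = Min (dual_re ` set (z # zs))"
proof (induction zs arbitrary: z)
  case Nil
  show ?case by simp
next
  case (Cons w zs)
  have "dual_re (foldl real_part_min z (w # zs)) =
      Min (insert (min (dual_re z) (dual_re w)) (dual_re ` set zs))"
    using Cons[of "real_part_min z w"] by (simp add: dual_re_real_part_min)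
  \<comment> \<open>The case split is there because \<open>Min\<close> of an insertion unfolds to
    \<open>min\<close> only over a nonempty set.\<close>
  also have "\<dots> = Min (dual_re ` set (z # w # zs))"
    by (cases "zs = []") (simp_all add: min.assoc)
  finally show ?case .
qed

lemma dual_re_real_part_min_list:
  assumes "zs \<noteq> []"
  shows "dual_re (real_part_min_list zs) = Min (dual_re ` set zs)"
  using assms dual_re_foldl_real_part_min[of "hd zs" "tl zs"]
  by (simp add: real_part_min_list_def)

lemma dual_re_dual_min_fun:
  assumes "p \<ge> 1"
  shows "dual_re (dual_min_fun p h (dual_lift v x)) = min_fun p h x"
proof -
  have "map (\<lambda>i. dual_extension (h i) (dual_lift v x)) [1..<Suc p] \<noteq> []"
    using assms by simp
  from dual_re_real_part_min_list[OF this] show ?thesis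
    unfolding dual_min_fun_def min_fun_def
    by (simp add: image_image dual_extension_lift atLeastLessThanSuc_atLeastAtMost
        del: upt_Suc)
qed

lemma min_fun_eq_iff:
  assumes "i \<in> {1..p}"
  shows "h i y = min_fun p h y \<longleftrightarrow> (\<forall>j\<in>{1..p}. h i y \<le> h j y)"
proof
  assume "h i y = min_fun p h y"
  then show "\<forall>j\<in>{1..p}. h i y \<le> h j y"
    by (simp add: min_fun_def)
next
  assume "\<forall>j\<in>{1..p}. h i y \<le> h j y"
  then have "Min ((\<lambda>i. h i y) ` {1..p}) = h i y"
    using assms by (intro Min_eqI) auto
  then show "h i y = min_fun p h y"
    by (simp add: min_fun_def)
qed

lemma min_active_in_active_set:
  assumes "p \<ge> 1"
  shows "min_active p h x \<in> active_set p h x"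
proof -
  have "min_fun p h x \<in> (\<lambda>i. h i x) ` {1..p}"
    unfolding min_fun_def using assms by (intro Min_in) auto
  then have "active_set p h x \<noteq> {}"
    by (auto simp: active_set_def)
  moreover have "finite (active_set p h x)"
    by (simp add: active_set_def)
  ultimately show ?thesis
    unfolding min_active_def by (rule Min_in[rotated])
qed

text \<open>The witness returns the first position at which the list attains its minimum. It is
  chosen before the family and the point, so it depends on \<open>p\<close> alone.\<close>

lemma min_active_function_of_values:
  "\<exists>\<phi> :: real list \<Rightarrow> nat. \<forall>(g :: nat \<Rightarrow> real^'n \<Rightarrow> real) y.
     min_active p g y = \<phi> (map (\<lambda>i. g i y) [1..<Suc p])"
proof (intro exI allI)
  fix g :: "nat \<Rightarrow> real^'n \<Rightarrow> real" and y
  \<comment> \<open>Lists count from 0 and the family from 1, hence the shift by one.\<close>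
  have nth: "map (\<lambda>i. g i y) [1..<Suc p] ! (i - 1) = g i y" if "i \<in> {1..p}" for i
    using that by (auto simp: nth_map_upt simp del: upt_Suc)
  have "Min (set (map (\<lambda>i. g i y) [1..<Suc p])) = min_fun p g y"
    by (simp add: min_fun_def atLeastLessThanSuc_atLeastAtMost del: upt_Suc)
  then have "active_set p g y = {i \<in> {1..p}. map (\<lambda>i. g i y) [1..<Suc p] ! (i - 1) =
      Min (set (map (\<lambda>i. g i y) [1..<Suc p]))}"
    unfolding active_set_def using nth by auto
  then show "min_active p g y = (\<lambda>xs. Min {i \<in> {1..p}. xs ! (i - 1) = Min (set xs)})
      (map (\<lambda>i. g i y) [1..<Suc p])"
    by (simp only: min_active_def)
qed

section \<open>Density of interiors in a finite closed cover\<close>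

lemma interior_UN_closed_empty:
  fixes T :: "'i \<Rightarrow> 'a::topological_space set"
  assumes "finite I" and "\<And>i. i \<in> I \<Longrightarrow> closed (T i)"
    and "\<And>i. i \<in> I \<Longrightarrow> interior (T i) = {}"
  shows "interior (\<Union>i\<in>I. T i) = {}"
  using assms
proof (induction I rule: finite_induct)
  case empty
  show ?case by simp
next
  case (insert i I)
  then have "interior (T i \<union> (\<Union>i\<in>I. T i)) = interior (T i)"
    by (intro interior_closed_Un_empty_interior) auto
  then show ?case using insert.prems by simp
qed

text \<open>A point of \<open>W\<close> outside all the closures lies in some \<open>T i\<close> but
  not in its interior. Such points form an open set inside a finite union of closed sets with empty
  interior, so there are none.\<close>

lemma finite_closed_cover_interior_dense:
  fixes T :: "'i \<Rightarrow> 'a::topological_space set"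
  assumes "finite I" and closed: "\<And>i. i \<in> I \<Longrightarrow> closed (T i)"
    and "open W" and cover: "W \<subseteq> (\<Union>i\<in>I. T i)"
  shows "W \<subseteq> (\<Union>i\<in>I. closure (interior (T i)))"
proof -
  define C where "C = (\<Union>i\<in>I. closure (interior (T i)))"
  have "closed C"
    unfolding C_def using \<open>finite I\<close> by (intro closed_UN) auto
  then have "open (W - C)"
    using \<open>open W\<close> by (rule open_Diff[rotated])
  have "interior (\<Union>i\<in>I. T i - interior (T i)) = {}"
  proof (rule interior_UN_closed_empty[OF \<open>finite I\<close>])
    fix i assume "i \<in> I"
    show "closed (T i - interior (T i))"
      using closed[OF \<open>i \<in> I\<close>] by (intro closed_Diff) auto
    \<comment> \<open>This interior lies in \<open>interior (T i)\<close> by monotonicity and is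
      disjoint from it by construction.\<close>
    show "interior (T i - interior (T i)) = {}"
      using interior_mono[of "T i - interior (T i)" "T i"]
        interior_subset[of "T i - interior (T i)"] by blast
  qed
  moreover have "W - C \<subseteq> (\<Union>i\<in>I. T i - interior (T i))"
  proof
    fix y assume y: "y \<in> W - C"
    then obtain i where "i \<in> I" "y \<in> T i"
      using cover by blast
    moreover have "y \<notin> interior (T i)"
      using y \<open>i \<in> I\<close> closure_subset[of "interior (T i)"] by (auto simp: C_def)
    ultimately show "y \<in> (\<Union>i\<in>I. T i - interior (T i))"
      by blast
  qed
  ultimately have "W - C = {}"
    using \<open>open (W - C)\<close> by (metis interior_maximal subset_empty)
  then show ?thesis
    by (auto simp: C_def)
qed

section \<open>Comparison along a ray\<close>

lemma GDERIV_eventually_less: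
  fixes f g :: "'a::real_inner \<Rightarrow> real"
  assumes "GDERIV f x :> F" and "GDERIV g x :> G" and "f x = g x" and "F \<bullet> d < G \<bullet> d"
  shows "\<forall>\<^sub>F t in at_right 0. f (x + t *\<^sub>R d) < g (x + t *\<^sub>R d)"
proof -
  have line: "((\<lambda>t. x + t *\<^sub>R d) has_derivative (\<lambda>t. t *\<^sub>R d)) (at 0)"
    by (auto intro!: derivative_eq_intros)
  have "((\<lambda>t. k (x + t *\<^sub>R d)) has_derivative (\<lambda>t. (t *\<^sub>R d) \<bullet> K)) (at 0)"
    if "GDERIV k x :> K" for k :: "'a \<Rightarrow> real" and K
    using has_derivative_compose[OF line, of k "\<lambda>w. w \<bullet> K"] that by (simp add: gderiv_def)
  \<comment> \<open>The difference along the ray vanishes at 0 and has positive slope there.\<close>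
  from has_derivative_diff[OF this[OF assms(2)] this[OF assms(1)]]
  have "((\<lambda>t. g (x + t *\<^sub>R d) - f (x + t *\<^sub>R d)) has_real_derivative (G \<bullet> d - F \<bullet> d)) (at 0)"
    unfolding has_field_derivative_def
    by (rule has_derivative_eq_rhs) (simp add: fun_eq_iff inner_commute algebra_simps)
  from DERIV_pos_inc_right[OF this] assms(3,4) obtain e where "e > 0"
    and "\<And>t. 0 < t \<Longrightarrow> t < e \<Longrightarrow> f (x + t *\<^sub>R d) < g (x + t *\<^sub>R d)"
    by auto
  then show ?thesis
    unfolding eventually_at_right_field by blast
qed

text \<open>Supplies a member on the same side of the hyperplane as \<open>f a\<close> whose
  gradient at \<open>x\<close> will turn out to be a limiting gradient of the minimum.\<close>

lemma exists_minimal_on_interior: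
  fixes f :: "'i \<Rightarrow> 'a::real_inner \<Rightarrow> real"
  assumes "open D" and "x \<in> D" and "finite I" and "a \<in> I"
    and cont: "\<And>i. i \<in> I \<Longrightarrow> continuous_on D (f i)"
    and deriv: "\<And>i. i \<in> I \<Longrightarrow> GDERIV (f i) x :> G i"
    and min: "\<And>i. i \<in> I \<Longrightarrow> f a x \<le> f i x"
    and "G a \<bullet> d < b"
  obtains i where "i \<in> I" and "x \<in> closure (interior {y \<in> D. \<forall>j\<in>I. f i y \<le> f j y})"
    and "G i \<bullet> d < b"
proof (rule ccontr)
  note found = that
  assume "\<not> thesis"
  define F where "F i = {y \<in> D. \<forall>j\<in>I. f i y \<le> f j y}" for i
  define J where "J = {i \<in> I. x \<in> closure (interior (F i))}"
  have J: "b \<le> G i \<bullet> d" if "i \<in> J" for i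
    using found[of i] that \<open>\<not> thesis\<close> by (force simp: J_def F_def)
  \<comment> \<open>\<open>F i\<close> is closed only relative to \<open>D\<close>, so the covering
    lemma is applied to closed sets \<open>T i\<close> with trace \<open>F i\<close> on
    \<open>D\<close>.\<close>
  have "\<exists>T. closed T \<and> F i = D \<inter> T" if "i \<in> I" for i
  proof -
    have "F i = (\<Inter>j\<in>I. D \<inter> (\<lambda>y. f j y - f i y) -` {0..})"
      using \<open>a \<in> I\<close> by (auto simp: F_def)
    moreover have "closedin (top_of_set D) (\<Inter>j\<in>I. D \<inter> (\<lambda>y. f j y - f i y) -` {0..})"
      using \<open>a \<in> I\<close> \<open>i \<in> I\<close>
      by (intro closedin_INT continuous_closedin_preimage continuous_on_diff cont) auto
    ultimately show ?thesis
      by (metis closedin_closed)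
  qed
  then obtain T where T: "\<And>i. i \<in> I \<Longrightarrow> closed (T i)" "\<And>i. i \<in> I \<Longrightarrow> F i = D \<inter> T i"
    by metis
  have F_closure: "y \<in> F i" if "y \<in> D" "y \<in> closure (interior (F i))" "i \<in> I" for i y
  proof -
    have "closure (interior (F i)) \<subseteq> T i"
      using T[OF \<open>i \<in> I\<close>] interior_subset by (metis closure_minimal inf_le2 subset_trans)
    with that T show ?thesis by blast
  qed
  have cover: "D \<subseteq> (\<Union>i\<in>I. closure (interior (F i)))"
  proof -
    have "D \<subseteq> (\<Union>i\<in>I. T i)"
    proof
      fix y assume "y \<in> D"
      have "Min ((\<lambda>i. f i y) ` I) \<in> (\<lambda>i. f i y) ` I"
        using \<open>finite I\<close> \<open>a \<in> I\<close> by (intro Min_in) auto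
      then obtain i where "i \<in> I" "Min ((\<lambda>i. f i y) ` I) = f i y"
        by auto
      then have "y \<in> F i"
        using \<open>finite I\<close> \<open>y \<in> D\<close> by (auto simp: F_def simp flip: \<open>_ = f i y\<close>)
      then show "y \<in> (\<Union>i\<in>I. T i)"
        using T \<open>i \<in> I\<close> by blast
    qed
    then have "D \<subseteq> (\<Union>i\<in>I. closure (interior (T i)))"
      by (intro finite_closed_cover_interior_dense \<open>finite I\<close> T(1) \<open>open D\<close>)
    \<comment> \<open>As \<open>D\<close> is open, the interior of \<open>D \<inter> T i\<close> is
      \<open>D \<inter> interior (T i)\<close>, and the closure of this still reaches every point of
      \<open>D\<close> in \<open>closure (interior (T i))\<close>.\<close>
    moreover have "D \<inter> closure (interior (T i)) \<subseteq> closure (interior (F i))" if "i \<in> I" for i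
      using open_Int_closure_subset[OF \<open>open D\<close>, of "interior (T i)"] T(2)[OF that] \<open>open D\<close>
      by (simp add: interior_open)
    ultimately show ?thesis by blast
  qed
  \<comment> \<open>In this neighbourhood of \<open>x\<close> only members of \<open>J\<close> can
    supply the cover.\<close>
  define N where "N = D - (\<Union>i\<in>I - J. closure (interior (F i)))"
  have "open N"
    unfolding N_def using \<open>open D\<close> \<open>finite I\<close> by (intro open_Diff closed_UN) auto
  have "x \<in> N"
    using \<open>x \<in> D\<close> by (auto simp: N_def J_def)
  have "((\<lambda>t. x + t *\<^sub>R d) \<longlongrightarrow> x + 0 *\<^sub>R d) (at_right 0)"
    by (intro tendsto_intros)
  then have "\<forall>\<^sub>F t in at_right 0. x + t *\<^sub>R d \<in> N"
    using \<open>open N\<close> \<open>x \<in> N\<close> by (auto dest: topological_tendstoD)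
  moreover have "\<forall>\<^sub>F t in at_right 0. \<forall>i\<in>J. f a (x + t *\<^sub>R d) < f i (x + t *\<^sub>R d)"
  proof (rule eventually_ball_finite)
    show "finite J"
      using \<open>finite I\<close> by (simp add: J_def)
    show "\<forall>i\<in>J. \<forall>\<^sub>F t in at_right 0. f a (x + t *\<^sub>R d) < f i (x + t *\<^sub>R d)"
    proof
      fix i assume "i \<in> J"
      then have "i \<in> I" "x \<in> F i"
        using F_closure \<open>x \<in> D\<close> by (auto simp: J_def)
      \<comment> \<open>Both members attain the minimum at \<open>x\<close>, so their slopes along
        \<open>d\<close> decide which is smaller just after \<open>x\<close>.\<close>
      then have "f a x = f i x"
        using min \<open>a \<in> I\<close> by (force simp: F_def)
      then show "\<forall>\<^sub>F t in at_right 0. f a (x + t *\<^sub>R d) < f i (x + t *\<^sub>R d)"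
        using GDERIV_eventually_less[OF deriv[OF \<open>a \<in> I\<close>] deriv[OF \<open>i \<in> I\<close>]]
          J[OF \<open>i \<in> J\<close>] \<open>G a \<bullet> d < b\<close> by simp
    qed
  qed
  ultimately have "\<forall>\<^sub>F t::real in at_right 0. False"
  proof eventually_elim
    case (elim t)
    then obtain i where i: "i \<in> J" "x + t *\<^sub>R d \<in> closure (interior (F i))"
      using cover unfolding N_def by blast
    then have "x + t *\<^sub>R d \<in> F i"
      using elim F_closure by (auto simp: N_def J_def)
    then show False
      using elim i \<open>a \<in> I\<close> by (force simp: F_def)
  qed
  then show False by simp
qed

section \<open>Gradients of the members as Clarke gradients of the minimum\<close>

lemma differentiable_gradient_eq_on_open:
  assumes "open U" and "y \<in> U" and "\<And>z. z \<in> U \<Longrightarrow> f z = g z" and "f differentiable (at y)"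
  shows "g differentiable (at y)" and "gradient g y = gradient f y"
proof -
  have "(f has_derivative (\<lambda>w. w \<bullet> gradient f y)) (at y)"
    using GDERIV_gradient[OF assms(4)] by (simp add: gderiv_def)
  then have "GDERIV g y :> gradient f y"
    unfolding gderiv_def using assms(1-3) by (rule has_derivative_transform_within_open)
  then show "g differentiable (at y)" and "gradient g y = gradient f y"
    by (auto simp: gradient_eqI gderiv_def differentiable_def)
qed

text \<open>Along a sequence in the open set of agreement the gradients of \<open>g\<close> are
  those of \<open>f\<close>, and these converge by continuity.\<close>

lemma gradient_mem_clarke_gradientI:
  assumes "x \<in> D" and "continuously_differentiable_on D f"
    and "x \<in> closure (interior {y \<in> D. f y = g y})"
  shows "gradient f x \<in> clarke_gradient D g x"
proof -
  let ?U = "interior {y \<in> D. f y = g y}"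
  obtain X where X: "\<And>k. X k \<in> ?U" "X \<longlonglongrightarrow> x"
    using assms(3) unfolding closure_sequential by blast
  have eq: "f y = g y" if "y \<in> ?U" for y
    using that interior_subset by blast
  have XD: "X k \<in> D" for k
    using X(1)[of k] interior_subset by blast
  then have diff: "f differentiable (at (X k))" for k
    using assms(2) by (simp add: continuously_differentiable_on_def)
  note gradient = differentiable_gradient_eq_on_open[OF open_interior X(1) eq diff]
  have "(\<lambda>k. gradient f (X k)) \<longlonglongrightarrow> gradient f x"
    using assms(1,2) XD X(2)
    by (intro continuous_on_tendsto_compose[of D "gradient f"])
      (simp_all add: continuously_differentiable_on_def)
  then have "(\<lambda>k. gradient g (X k)) \<longlonglongrightarrow> gradient f x"
    by (simp only: gradient(2))
  then have "\<exists>X. (\<forall>k. X k \<in> D - {y \<in> D. \<not> g differentiable (at y)}) \<and> X \<longlonglongrightarrow> x \<and>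
      (\<lambda>k. gradient g (X k)) \<longlonglongrightarrow> gradient f x"
    using XD X(2) gradient(1) by (intro exI[of _ X]) simp
  then show ?thesis
    unfolding clarke_gradient_def closed_convex_hull_def
    by (intro subsetD[OF closure_subset] hull_inc CollectI)
qed

lemma active_gradient_mem_clarke_gradient:
  fixes D :: "(real^'n) set"
  assumes "open D" and "x \<in> D"
    and C1: "\<And>i. i \<in> {1..p} \<Longrightarrow> continuously_differentiable_on D (h i)"
    and active: "a \<in> active_set p h x"
  shows "gradient (h a) x \<in> clarke_gradient D (min_fun p h) x"
proof (rule ccontr)
  let ?C = "clarke_gradient D (min_fun p h) x"
  assume "gradient (h a) x \<notin> ?C"
  moreover have "convex ?C" "closed ?C"
    by (simp_all add: clarke_gradient_def closed_convex_hull_def)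
  \<comment> \<open>Strictness on the side of \<open>?C\<close> is what excludes the member found
    below.\<close>
  ultimately obtain d b where a: "d \<bullet> gradient (h a) x < b"
    and C: "\<And>w. w \<in> ?C \<Longrightarrow> b < d \<bullet> w"
    using separating_hyperplane_closed_point by metis
  have "a \<in> {1..p}" and min: "\<And>i. i \<in> {1..p} \<Longrightarrow> h a x \<le> h i x"
    using active min_fun_eq_iff[of a p h x] by (auto simp: active_set_def)
  have diff: "h i differentiable (at y)" if "i \<in> {1..p}" "y \<in> D" for i y
    using C1 that by (simp add: continuously_differentiable_on_def)
  have cont: "continuous_on D (h i)" if "i \<in> {1..p}" for i
    using diff[OF that] by (intro continuous_at_imp_continuous_on ballI)
      (rule differentiable_imp_continuous_within)
  obtain i where i: "i \<in> {1..p}"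
    "x \<in> closure (interior {y \<in> D. \<forall>j\<in>{1..p}. h i y \<le> h j y})" "gradient (h i) x \<bullet> d < b"
    using exists_minimal_on_interior[where f = h and I = "{1..p}" and G = "\<lambda>i. gradient (h i) x",
        OF \<open>open D\<close> \<open>x \<in> D\<close> finite_atLeastAtMost \<open>a \<in> {1..p}\<close> cont
        GDERIV_gradient[OF diff[OF _ \<open>x \<in> D\<close>]] min, of d b] a
    by (auto simp: inner_commute)
  then have "gradient (h i) x \<in> ?C"
    using gradient_mem_clarke_gradientI[OF \<open>x \<in> D\<close> C1] min_fun_eq_iff[OF i(1), of h] by simp
  then show False
    using C i(3) by (force simp: inner_commute)
qed

text \<open>The convex hull of a finite set is compact, so taking the closure adds nothing.\<close>

lemma extreme_point_of_closed_convex_hull_affine_independent: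
  assumes "finite S" and "\<not> affine_dependent S" and "w \<in> S"
  shows "w extreme_point_of closed_convex_hull S"
  using assms
  by (simp add: closed_convex_hull_def compact_imp_closed finite_imp_compact_convex_hull
      extreme_point_of_convex_hull_affine_independent)

theorem theorem2:
  fixes D :: "(real^'n) set" and x :: "real^'n" and v :: "real^'n \<Rightarrow> real^'n"
    and p :: nat and h :: "nat \<Rightarrow> real^'n \<Rightarrow> real"
  assumes "open D" and "x \<in> D" and "continuous_on D v"
    and "p \<ge> 1"
    and "\<And>i. i \<in> {1..p} \<Longrightarrow> continuously_differentiable_on D (h i)"
  shows "dual_re (dual_min_fun p h (dual_lift v x)) = min_fun p h x
    \<and> gradient (h (min_active p h x)) x \<in> (\<lambda>i. gradient (h i) x) ` active_set p h x
    \<and> gradient (h (min_active p h x)) x \<in> clarke_gradient D (min_fun p h) x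
    \<and> (\<not> affine_dependent ((\<lambda>i. gradient (h i) x) ` active_set p h x) \<longrightarrow>
         gradient (h (min_active p h x)) x extreme_point_of
           closed_convex_hull ((\<lambda>i. gradient (h i) x) ` active_set p h x))
    \<and> (\<exists>\<phi> :: real list \<Rightarrow> nat. \<forall>g :: nat \<Rightarrow> real^'n \<Rightarrow> real. \<forall>y\<in>D.
         min_active p g y = \<phi> (map (\<lambda>i. g i y) [1..<Suc p]))"
proof (intro conjI impI)
  let ?a = "min_active p h x" and ?G = "(\<lambda>i. gradient (h i) x) ` active_set p h x"
  have a: "?a \<in> active_set p h x"
    using \<open>p \<ge> 1\<close> by (rule min_active_in_active_set)
  show "dual_re (dual_min_fun p h (dual_lift v x)) = min_fun p h x"
    using \<open>p \<ge> 1\<close> by (rule dual_re_dual_min_fun)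
  show G: "gradient (h ?a) x \<in> ?G"
    using a by (rule imageI)
  show "gradient (h ?a) x \<in> clarke_gradient D (min_fun p h) x"
    using assms(1,2,5) a by (rule active_gradient_mem_clarke_gradient)
  \<comment> \<open>Affine independence concerns the set of gradients: active indices with equal
    gradients count once.\<close>
  show "gradient (h ?a) x extreme_point_of closed_convex_hull ?G" if "\<not> affine_dependent ?G"
    using that G
    by (intro extreme_point_of_closed_convex_hull_affine_independent) (simp_all add: active_set_def)
  show "\<exists>\<phi> :: real list \<Rightarrow> nat. \<forall>g :: nat \<Rightarrow> real^'n \<Rightarrow> real. \<forall>y\<in>D.
      min_active p g y = \<phi> (map (\<lambda>i. g i y) [1..<Suc p])"
    using min_active_function_of_values by blast
qed

end
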